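(* Let $X,Y$ be complex Banach spaces, let $0<\beta\le 1$, let $\varphi:\mathbb{D}\to\mathbb{D}$ be analytic and let $\psi:\mathbb{D}\to L(X,Y)$ be analytic. Then the operator $W_{\psi,\varphi}:\Lambda_1(X)\to\Lambda_\beta(Y)$ is well defined and bounded if and only if $\psi\in\Lambda_\beta(L(X,Y))$ and $\varphi'\psi\in H^\infty_{\nu_{1-\beta}}(L(X,Y))$. Furthermore, in this case, $$\|W_{\psi,\varphi}:\Lambda_1(X)\to\Lambda_\beta(Y)\|\asymp\max\{\|\varphi'\psi\|_{H^\infty_{\nu_{1-\beta}}},\ \|\psi\|_{\Lambda_\beta}\},$$ i.e. there are constants $a,b>0$, not depending on $\psi$ or $\varphi$, such that $a\,\|W_{\psi,\varphi}\|\le \max\{\|\varphi'\psi\|_{H^\infty_{\nu_{1-\beta}}},\|\psi\|_{\Lambda_\beta}\}\le b\,\|W_{\psi,\varphi}\|$, where $\|\psi\|_{\Lambda_\beta}$ is the norm of $\psi$ in $\Lambda_\beta(L(X,Y))$.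
   Context: $\mathbb{D}$ is the open unit disk of $\mathbb{C}$. $L(X,Y)$ is the Banach space of bounded linear operators $X\to Y$ with the operator norm. For a complex Banach space $X$, $H(\mathbb{D},X)$ is the space of analytic functions $\mathbb{D}\to X$. For $\alpha\in(0,1]$, $\Lambda_\alpha(X)$ is the space of all $f\in H(\mathbb{D},X)$ with $p_\alpha(f)=\sup_{z\ne w\in\mathbb{D}}\|f(z)-f(w)\|/|z-w|^\alpha<\infty$. It is a Banach space under $\|f\|_\alpha=\sup_{z\in\mathbb{D}}\|f(z)\|+p_\alpha(f)$. For $\alpha\in(0,1)$ it is equipped with the equivalent norm $\|f\|_{\Lambda_\alpha(X)}=\|f(0)\|+\sup_{z\in\mathbb{D}}(1-|z|^2)^{1-\alpha}\|f'(z)\|$; for $\alpha=1$ it is equipped with $\|\cdot\|_1$. The same definitions apply with $X$ replaced by $Y$ or $L(X,Y)$ and $\alpha$ by $\beta$. For $\gamma\ge0$ let $\nu_\gamma(z)=(1-|z|^2)^\gamma$; for a Banach space $Z$, $H^\infty_{\nu_\gamma}(Z)$ is the Banach space of $g\in H(\mathbb{D},Z)$ with $\|g\|_{H^\infty_{\nu_\gamma}}=\sup_{z\in\mathbb{D}}\nu_\gamma(z)\|g(z)\|<\infty$. Write $\psi_z=\psi(z)\in L(X,Y)$. The weighted composition operator is $W_{\psi,\varphi}(f)(z)=\psi_z(f(\varphi(z)))$, $z\in\mathbb{D}$, for $f:\mathbb{D}\to X$; and $(\varphi'\psi)(z)=\varphi'(z)\psi_z$. *)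

theory Defs
  imports "HOL-Analysis.Analysis"
begin

section \<open>Complex Banach spaces\<close>

class complex_normed_vector = real_normed_vector +
  fixes scaleC :: "complex \<Rightarrow> 'a \<Rightarrow> 'a" (infixr \<open>*\<^sub>C\<close> 75)
  assumes scaleC_add_right: "c *\<^sub>C (x + y) = c *\<^sub>C x + c *\<^sub>C y"
    and scaleC_add_left: "(c + d) *\<^sub>C x = c *\<^sub>C x + d *\<^sub>C x"
    and scaleC_scaleC: "c *\<^sub>C d *\<^sub>C x = (c * d) *\<^sub>C x"
    and scaleC_of_real: "complex_of_real r *\<^sub>C x = r *\<^sub>R x"
    and norm_scaleC: "norm (c *\<^sub>C x) = cmod c * norm x"

class complex_banach = complex_normed_vector + banach

instantiation complex :: complex_banach
begin
definition scaleC_complex :: "complex \<Rightarrow> complex \<Rightarrow> complex"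
  where "scaleC_complex c x = c * x"
instance
  by standard (simp_all add: scaleC_complex_def algebra_simps norm_mult scaleR_conv_of_real)
end

lemma scaleC_one [simp]: "1 *\<^sub>C x = (x :: 'a::complex_normed_vector)"
  using scaleC_of_real[of 1 x] by simp

lemma bounded_bilinear_scaleC:
  "bounded_bilinear ((*\<^sub>C) :: complex \<Rightarrow> 'a::complex_normed_vector \<Rightarrow> 'a)"
proof
  fix r :: real and c :: complex and x :: 'a
  show "(r *\<^sub>R c) *\<^sub>C x = r *\<^sub>R (c *\<^sub>C x)"
    by (simp add: scaleR_conv_of_real scaleC_scaleC flip: scaleC_of_real)
  show "c *\<^sub>C (r *\<^sub>R x) = r *\<^sub>R (c *\<^sub>C x)"
    by (simp add: scaleC_scaleC mult.commute flip: scaleC_of_real)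
  show "\<exists>K. \<forall>(c::complex) (x::'a). norm (c *\<^sub>C x) \<le> cmod c * norm x * K"
    by (rule exI[of _ 1]) (simp add: norm_scaleC)
qed (simp_all add: scaleC_add_right scaleC_add_left)

lemma uminus_scaleC_right: "c *\<^sub>C (- x) = - (c *\<^sub>C (x :: 'a::complex_normed_vector))"
  by (rule bounded_bilinear.minus_right[OF bounded_bilinear_scaleC])

lemma diff_scaleC_right:
  "c *\<^sub>C (x - y) = c *\<^sub>C x - c *\<^sub>C (y :: 'a::complex_normed_vector)"
  by (rule bounded_bilinear.diff_right[OF bounded_bilinear_scaleC])

section \<open>The Banach space \<open>L(X,Y)\<close>\<close>

text \<open>
  The complex-linear members of the library type of bounded real-linear maps. The norm is
  inherited; it is the usual operator norm.
\<close>

typedef (overloaded) ('a, 'b) cblinfun =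
  "{T :: 'a::complex_normed_vector \<Rightarrow>\<^sub>L 'b::complex_normed_vector.
      \<forall>c x. blinfun_apply T (c *\<^sub>C x) = c *\<^sub>C blinfun_apply T x}"
  morphisms blinfun_of Abs_cblinfun
  by (rule exI[of _ 0])
    (simp add: bounded_bilinear.zero_right[OF bounded_bilinear_scaleC])

setup_lifting type_definition_cblinfun

lift_definition cblinfun_apply ::
  "('a::complex_normed_vector, 'b::complex_normed_vector) cblinfun \<Rightarrow> 'a \<Rightarrow> 'b"
  is blinfun_apply .

instantiation cblinfun :: (complex_normed_vector, complex_normed_vector) real_normed_vector
begin

lift_definition zero_cblinfun :: "('a, 'b) cblinfun" is 0
  by (simp add: bounded_bilinear.zero_right[OF bounded_bilinear_scaleC])

lift_definition plus_cblinfun :: "('a, 'b) cblinfun \<Rightarrow> ('a, 'b) cblinfun \<Rightarrow> ('a, 'b) cblinfun"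
  is "(+)" by (simp add: blinfun.add_left scaleC_add_right)

lift_definition minus_cblinfun :: "('a, 'b) cblinfun \<Rightarrow> ('a, 'b) cblinfun \<Rightarrow> ('a, 'b) cblinfun"
  is "(-)" by (simp add: blinfun.diff_left diff_scaleC_right)

lift_definition uminus_cblinfun :: "('a, 'b) cblinfun \<Rightarrow> ('a, 'b) cblinfun"
  is "uminus" by (simp add: blinfun.minus_left uminus_scaleC_right)

lift_definition scaleR_cblinfun :: "real \<Rightarrow> ('a, 'b) cblinfun \<Rightarrow> ('a, 'b) cblinfun"
  is "(*\<^sub>R)"
  by (simp add: blinfun.scaleR_left scaleC_scaleC mult.commute flip: scaleC_of_real)

lift_definition norm_cblinfun :: "('a, 'b) cblinfun \<Rightarrow> real" is norm .

definition dist_cblinfun :: "('a, 'b) cblinfun \<Rightarrow> ('a, 'b) cblinfun \<Rightarrow> real"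
  where "dist_cblinfun S T = norm (S - T)"

definition sgn_cblinfun :: "('a, 'b) cblinfun \<Rightarrow> ('a, 'b) cblinfun"
  where "sgn_cblinfun T = inverse (norm T) *\<^sub>R T"

definition uniformity_cblinfun :: "(('a, 'b) cblinfun \<times> ('a, 'b) cblinfun) filter"
  where "uniformity_cblinfun = (INF e\<in>{0<..}. principal {(S, T). dist S T < e})"

definition open_cblinfun :: "('a, 'b) cblinfun set \<Rightarrow> bool"
  where "open_cblinfun U = (\<forall>T\<in>U. \<forall>\<^sub>F (T', S) in uniformity. T' = T \<longrightarrow> S \<in> U)"

instance
proof
  fix S T U :: "('a, 'b) cblinfun" and r s :: real
  show "dist S T = norm (S - T)" by (rule dist_cblinfun_def)
  show "sgn T = inverse (norm T) *\<^sub>R T" by (rule sgn_cblinfun_def)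
  show "(uniformity :: (('a, 'b) cblinfun \<times> _) filter)
      = (INF e\<in>{0<..}. principal {(S, T). dist S T < e})"
    by (rule uniformity_cblinfun_def)
  show "open V = (\<forall>T\<in>V. \<forall>\<^sub>F (T', S) in uniformity. T' = T \<longrightarrow> S \<in> V)"
    for V :: "('a, 'b) cblinfun set"
    by (rule open_cblinfun_def)
  show "S + T + U = S + (T + U)" by transfer simp
  show "S + T = T + S" by transfer simp
  show "0 + T = T" by transfer simp
  show "- T + T = 0" by transfer simp
  show "S - T = S + - T" by transfer simp
  show "r *\<^sub>R (S + T) = r *\<^sub>R S + r *\<^sub>R T" by transfer (rule scaleR_add_right)
  show "(r + s) *\<^sub>R T = r *\<^sub>R T + s *\<^sub>R T" by transfer (rule scaleR_add_left)
  show "r *\<^sub>R s *\<^sub>R T = (r * s) *\<^sub>R T" by transfer simp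
  show "1 *\<^sub>R T = T" by transfer simp
  show "norm T = 0 \<longleftrightarrow> T = 0" by transfer simp
  show "norm (S + T) \<le> norm S + norm T" by transfer (rule norm_triangle_ineq)
  show "norm (r *\<^sub>R T) = \<bar>r\<bar> * norm T" by transfer simp
qed

end

lemma norm_cblinfun_eq_SUP: "norm T = (SUP x. norm (cblinfun_apply T x) / norm x)"
  by transfer (simp add: norm_blinfun.rep_eq onorm_def)

lemma bounded_linear_scaleC_comp:
  fixes f :: "'c::real_normed_vector \<Rightarrow> 'b::complex_normed_vector"
  assumes "bounded_linear f"
  shows "bounded_linear (\<lambda>x. c *\<^sub>C f x)"
  using bounded_linear_compose[OF bounded_bilinear.bounded_linear_right[OF bounded_bilinear_scaleC] assms] .

lift_definition blinfun_scaleC ::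
  "complex \<Rightarrow> ('c::real_normed_vector \<Rightarrow>\<^sub>L 'b::complex_normed_vector) \<Rightarrow> ('c \<Rightarrow>\<^sub>L 'b)"
  is "\<lambda>c f x. c *\<^sub>C f x" by (rule bounded_linear_scaleC_comp)

lemma norm_blinfun_scaleC_le: "norm (blinfun_scaleC c T) \<le> cmod c * norm T"
proof (rule norm_blinfun_bound)
  show "norm (blinfun_apply (blinfun_scaleC c T) x) \<le> cmod c * norm T * norm x" for x
    using mult_left_mono[OF norm_blinfun, of "cmod c" T x]
    by (simp add: blinfun_scaleC.rep_eq norm_scaleC mult.assoc)
qed simp

lemma norm_blinfun_scaleC: "norm (blinfun_scaleC c T) = cmod c * norm T"
proof (cases "c = 0")
  case False
  have "blinfun_scaleC (inverse c) (blinfun_scaleC c T) = T"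
    using False by (intro blinfun_eqI) (simp add: blinfun_scaleC.rep_eq scaleC_scaleC)
  then have "norm T \<le> inverse (cmod c) * norm (blinfun_scaleC c T)"
    by (metis norm_blinfun_scaleC_le norm_inverse)
  then have "cmod c * norm T \<le> norm (blinfun_scaleC c T)"
    using False by (simp add: field_simps)
  then show ?thesis using norm_blinfun_scaleC_le[of c T] by simp
qed (use norm_blinfun_scaleC_le[of c T] in simp)

instantiation cblinfun :: (complex_normed_vector, complex_normed_vector) complex_normed_vector
begin

lift_definition scaleC_cblinfun :: "complex \<Rightarrow> ('a, 'b) cblinfun \<Rightarrow> ('a, 'b) cblinfun"
  is blinfun_scaleC
  by (simp add: blinfun_scaleC.rep_eq scaleC_scaleC mult.commute)

instance
proof
  fix S T :: "('a, 'b) cblinfun" and c d :: complex and r :: real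
  show "c *\<^sub>C (S + T) = c *\<^sub>C S + c *\<^sub>C T"
    by transfer (rule blinfun_eqI, simp add: blinfun_scaleC.rep_eq blinfun.add_left scaleC_add_right)
  show "(c + d) *\<^sub>C T = c *\<^sub>C T + d *\<^sub>C T"
    by transfer (rule blinfun_eqI, simp add: blinfun_scaleC.rep_eq blinfun.add_left scaleC_add_left)
  show "c *\<^sub>C d *\<^sub>C T = (c * d) *\<^sub>C T"
    by transfer (rule blinfun_eqI, simp add: blinfun_scaleC.rep_eq scaleC_scaleC)
  show "complex_of_real r *\<^sub>C T = r *\<^sub>R T"
    by transfer (rule blinfun_eqI, simp add: blinfun_scaleC.rep_eq blinfun.scaleR_left scaleC_of_real)
  show "norm (c *\<^sub>C T) = cmod c * norm T"
    by transfer (rule norm_blinfun_scaleC)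
qed

end

lemma dist_blinfun_of: "dist (blinfun_of S) (blinfun_of T) = dist S T"
  unfolding dist_norm by transfer simp

instance cblinfun :: (complex_normed_vector, complex_banach) complex_banach
proof
  fix T :: "nat \<Rightarrow> ('a, 'b) cblinfun"
  assume "Cauchy T"
  then have "Cauchy (\<lambda>n. blinfun_of (T n))"
    by (simp add: Cauchy_def dist_blinfun_of)
  then obtain L where L: "(\<lambda>n. blinfun_of (T n)) \<longlonglongrightarrow> L"
    using Cauchy_convergent_iff convergent_def by blast
  have lim: "(\<lambda>n. blinfun_apply (blinfun_of (T n)) x) \<longlonglongrightarrow> blinfun_apply L x" for x
    by (intro tendsto_intros L)
  have "blinfun_apply L (c *\<^sub>C x) = c *\<^sub>C blinfun_apply L x" for c x
  proof (rule LIMSEQ_unique[OF lim])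
    have "blinfun_apply (blinfun_of (T n)) (c *\<^sub>C x) = c *\<^sub>C blinfun_apply (blinfun_of (T n)) x" for n
      using blinfun_of[of "T n"] by simp
    then show "(\<lambda>n. blinfun_apply (blinfun_of (T n)) (c *\<^sub>C x)) \<longlonglongrightarrow> c *\<^sub>C blinfun_apply L x"
      by (simp add: bounded_bilinear.tendsto[OF bounded_bilinear_scaleC tendsto_const lim])
  qed
  then have "blinfun_of (Abs_cblinfun L) = L"
    by (simp add: Abs_cblinfun_inverse)
  then have "T \<longlonglongrightarrow> Abs_cblinfun L"
    using L unfolding tendsto_iff by (metis (no_types, lifting) dist_blinfun_of eventually_mono)
  then show "convergent T" by (auto simp: convergent_def)
qed

section \<open>Vector-valued analytic functions on the unit disc\<close>

text \<open>
  A function on the disc is represented by a total function on the complex plane whose values off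
  the disc play no role: membership in the spaces below and the norms do not depend on them.
\<close>

abbreviation unit_disc :: "complex set"
  where "unit_disc \<equiv> ball 0 1"

definition has_cderiv :: "(complex \<Rightarrow> 'a::complex_normed_vector) \<Rightarrow> 'a \<Rightarrow> complex \<Rightarrow> bool"
  where "has_cderiv f D z \<longleftrightarrow> (f has_derivative (\<lambda>h. h *\<^sub>C D)) (at z)"

definition cderiv :: "(complex \<Rightarrow> 'a::complex_normed_vector) \<Rightarrow> complex \<Rightarrow> 'a"
  where "cderiv f z = (THE D. has_cderiv f D z)"

lemma has_cderiv_imp_cderiv:
  assumes "has_cderiv f D z"
  shows "cderiv f z = D"
  unfolding cderiv_def
proof (rule the_equality)
  show "has_cderiv f D z" by (rule assms)
next
  fix E assume "has_cderiv f E z"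
  then have "(\<lambda>h. h *\<^sub>C E) = (\<lambda>h. h *\<^sub>C D)"
    using assms has_derivative_unique unfolding has_cderiv_def by blast
  from fun_cong[OF this, of 1] show "E = D" by simp
qed

lemma has_cderiv_complex_iff: "has_cderiv f D z \<longleftrightarrow> (f has_field_derivative D) (at z)"
  by (simp add: has_cderiv_def has_field_derivative_def scaleC_complex_def
      mult.commute[of _ D])

definition analytic_disc :: "(complex \<Rightarrow> 'a::complex_banach) set"
  where "analytic_disc = {f. \<forall>z\<in>unit_disc. \<exists>D. has_cderiv f D z}"

lemma analytic_disc_complex_iff: "f \<in> analytic_disc \<longleftrightarrow> f holomorphic_on unit_disc"
  by (simp add: analytic_disc_def has_cderiv_complex_iff holomorphic_on_open)

section \<open>Lipschitz spaces and weighted spaces\<close>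

text \<open>On the disc the base of the power is positive, so exponent \<open>0\<close> gives the weight \<open>1\<close>.\<close>

definition weight :: "real \<Rightarrow> complex \<Rightarrow> real"
  where "weight \<gamma> z = (1 - (cmod z)\<^sup>2) powr \<gamma>"

definition holder_quotients :: "real \<Rightarrow> (complex \<Rightarrow> 'a::complex_banach) \<Rightarrow> real set"
  where "holder_quotients \<alpha> f =
    {norm (f z - f w) / cmod (z - w) powr \<alpha> | z w. z \<in> unit_disc \<and> w \<in> unit_disc \<and> z \<noteq> w}"

definition lip_space :: "real \<Rightarrow> (complex \<Rightarrow> 'a::complex_banach) set"
  where "lip_space \<alpha> = {f \<in> analytic_disc. bdd_above (holder_quotients \<alpha> f)}"

text \<open>For exponents below \<open>1\<close> the space carries the equivalent norm given by the derivative.\<close>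

definition lip_norm :: "real \<Rightarrow> (complex \<Rightarrow> 'a::complex_banach) \<Rightarrow> real"
  where "lip_norm \<alpha> f =
    (if \<alpha> = 1 then (SUP z\<in>unit_disc. norm (f z)) + Sup (holder_quotients 1 f)
     else norm (f 0) + (SUP z\<in>unit_disc. weight (1 - \<alpha>) z * norm (cderiv f z)))"

definition Hinf_space :: "real \<Rightarrow> (complex \<Rightarrow> 'a::complex_banach) set"
  where "Hinf_space \<gamma> = {g \<in> analytic_disc. bdd_above ((\<lambda>z. weight \<gamma> z * norm (g z)) ` unit_disc)}"

definition Hinf_norm :: "real \<Rightarrow> (complex \<Rightarrow> 'a::complex_banach) \<Rightarrow> real"
  where "Hinf_norm \<gamma> g = (SUP z\<in>unit_disc. weight \<gamma> z * norm (g z))"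

section \<open>Operators between Lipschitz spaces\<close>

definition wcomp ::
  "(complex \<Rightarrow> ('a, 'b) cblinfun) \<Rightarrow> (complex \<Rightarrow> complex) \<Rightarrow>
    (complex \<Rightarrow> 'a::complex_banach) \<Rightarrow> complex \<Rightarrow> 'b::complex_banach"
  where "wcomp \<psi> \<phi> f z = cblinfun_apply (\<psi> z) (f (\<phi> z))"

text \<open>
  Boundedness and operator norm of a map from the space with exponent \<open>\<alpha>\<close> to the space with
  exponent \<open>\<beta>\<close>; they are meant for linear maps such as the weighted composition operators.
\<close>

definition lip_bounded_op ::
  "real \<Rightarrow> real \<Rightarrow> ((complex \<Rightarrow> 'a::complex_banach) \<Rightarrow> (complex \<Rightarrow> 'b::complex_banach)) \<Rightarrow> bool"
  where "lip_bounded_op \<alpha> \<beta> W \<longleftrightarrow>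
    W ` lip_space \<alpha> \<subseteq> lip_space \<beta> \<and>
    (\<exists>C. \<forall>f\<in>lip_space \<alpha>. lip_norm \<beta> (W f) \<le> C * lip_norm \<alpha> f)"

definition lip_op_norm ::
  "real \<Rightarrow> real \<Rightarrow> ((complex \<Rightarrow> 'a::complex_banach) \<Rightarrow> (complex \<Rightarrow> 'b::complex_banach)) \<Rightarrow> real"
  where "lip_op_norm \<alpha> \<beta> W = (SUP f\<in>{f \<in> lip_space \<alpha>. lip_norm \<alpha> f \<le> 1}. lip_norm \<beta> (W f))"

end

theory Submission
  imports Defs "HOL-Complex_Analysis.Complex_Analysis"
begin

text \<open>
  Everything rests on describing \<open>lip_space \<beta>\<close>, for \<open>0 < \<beta> \<le> 1\<close>, by the growth of the derivative:
  \<open>f\<close> is Hoelder of exponent \<open>\<beta>\<close> on the disc iff \<open>weight (1 - \<beta>) z * norm (cderiv f z)\<close> is bounded,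
  and \<open>lip_norm \<beta> f\<close> is comparable with \<open>norm (f 0)\<close> plus that bound. With this description both
  directions become manipulations of the product rule
  \<open>(W f)' = \<psi>' (f \<circ> \<phi>) + (\<phi>' \<psi>) (f' \<circ> \<phi>)\<close>, where \<open>W = wcomp \<psi> \<phi>\<close>.

  If \<open>\<psi>\<close> is Hoelder and \<open>\<phi>' \<psi>\<close> has finite weighted norm, then a Lipschitz \<open>f\<close> has \<open>f\<close> and \<open>f'\<close>
  bounded by multiples of \<open>lip_norm 1 f\<close>, so both summands of \<open>(W f)'\<close> obey the required growth
  (\<open>wcomp_bound_if_multiplier\<close>). Conversely, applying \<open>W\<close> to the constants \<open>x\<close> controls \<open>\<psi> x\<close>,
  hence \<open>\<psi>' x\<close>. Applying it to \<open>w \<mapsto> w x\<close> gives \<open>(W f)' = \<phi> \<psi>' x + \<phi>' \<psi> x\<close>, and since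
  \<open>\<bar>\<phi>\<bar> < 1\<close> the first summand is already controlled, so \<open>\<phi>' \<psi> x\<close> is as well. These bounds are
  uniform over \<open>x\<close> in a ball and therefore hold for the operator norms
  (\<open>multiplier_bound_if_wcomp\<close>).

  The description of \<open>lip_space \<beta>\<close> has two halves. The growth of the derivative follows from
  Cauchy's estimate on the disc of radius \<open>(1 - \<bar>z\<bar>) / 2\<close> about \<open>z\<close>
  (\<open>lip_space_weighted_cderiv_le\<close>). For vector values the estimate is reduced to scalar functions by
  composing with a functional that is large on \<open>cderiv f z\<close>, which the Hahn--Banach theorem supplies.
  The other half is the Hardy--Littlewood argument (\<open>norm_diff_le_powr\<close>): two points at distance
  \<open>\<delta>\<close> are joined through a point at depth about \<open>\<delta>\<close> inside the disc, and the bound on the derivative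
  is integrable along the two segments.

  The constants are far from optimal; what matters is that they depend on neither \<open>\<psi>\<close> nor \<open>\<phi>\<close>.
\<close>

section \<open>The Hahn--Banach theorem\<close>

text \<open>
  Only one inequality is demanded in the homogeneity clause, because the infima formed below are
  easier to bound on one side; the reverse inequality follows by rescaling with \<open>inverse r\<close>
  (\<open>sublinear_scaleR\<close>).
\<close>

definition sublinear :: "('a::real_vector \<Rightarrow> real) \<Rightarrow> bool"
  where "sublinear p \<longleftrightarrow>
    (\<forall>x y. p (x + y) \<le> p x + p y) \<and> (\<forall>r x. 0 \<le> r \<longrightarrow> p (r *\<^sub>R x) \<le> r * p x)"

lemma sublinearI:
  assumes "\<And>x y. p (x + y) \<le> p x + p y"
    and "p 0 \<le> 0"
    and "\<And>r x. 0 < r \<Longrightarrow> p (r *\<^sub>R x) \<le> r * p x"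
  shows "sublinear p"
proof -
  have "p (r *\<^sub>R x) \<le> r * p x" if "0 \<le> r" for r x
    using assms(2) assms(3)[of r x] that by (cases "r = 0") simp_all
  with assms(1) show ?thesis by (simp add: sublinear_def)
qed

lemma sublinear_add: "sublinear p \<Longrightarrow> p (x + y) \<le> p x + p y"
  by (simp add: sublinear_def)

lemma sublinear_zero: "sublinear p \<Longrightarrow> p 0 = 0"
proof -
  assume p: "sublinear p"
  have "p (0 *\<^sub>R 0) \<le> 0 * p 0" using p unfolding sublinear_def by blast
  moreover have "p (0 + 0) \<le> p 0 + p 0" using p by (rule sublinear_add)
  ultimately show "p 0 = 0" by simp
qed

lemma sublinear_scaleR:
  assumes "sublinear p" "0 \<le> r"
  shows "p (r *\<^sub>R x) = r * p x"
proof (cases "r = 0")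
  case True
  then show ?thesis using sublinear_zero[OF assms(1)] by simp
next
  case False
  have "p (inverse r *\<^sub>R r *\<^sub>R x) \<le> inverse r * p (r *\<^sub>R x)"
    using assms unfolding sublinear_def by (meson inverse_nonnegative_iff_nonnegative)
  with False assms(2) have "r * p x \<le> p (r *\<^sub>R x)"
    by (simp add: field_simps)
  then show ?thesis using assms by (simp add: sublinear_def antisym)
qed

lemma sublinear_ge_uminus:
  assumes "sublinear p"
  shows "- p (- x) \<le> p x"
  using sublinear_add[OF assms, of x "- x"] sublinear_zero[OF assms] by simp

text \<open>
  Lowers \<open>p\<close> as far as possible along \<open>- y\<close> while keeping it sublinear and leaving its value at \<open>y\<close>
  alone. It is used twice: a minimal sublinear functional must equal all its tilts, which makes it
  additive, and tilting the norm along \<open>v\<close> forces every linear functional below it to take the value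
  \<open>norm v\<close> at \<open>v\<close>.
\<close>

definition tilt :: "('a::real_vector \<Rightarrow> real) \<Rightarrow> 'a \<Rightarrow> 'a \<Rightarrow> real"
  where "tilt p y x = (INF t\<in>{0..}. p (x + t *\<^sub>R y) - t * p y)"

context
  fixes p :: "'a::real_vector \<Rightarrow> real" and y :: 'a
  assumes p: "sublinear p"
begin

lemma tilt_le:
  assumes "0 \<le> t"
  shows "tilt p y x \<le> p (x + t *\<^sub>R y) - t * p y"
  unfolding tilt_def
proof (rule cINF_lower)
  show "bdd_below ((\<lambda>t. p (x + t *\<^sub>R y) - t * p y) ` {0..})"
  proof (rule bdd_belowI2)
    fix t :: real assume "t \<in> {0..}"
    then show "- p (- x) \<le> p (x + t *\<^sub>R y) - t * p y"
      using sublinear_add[OF p, of "x + t *\<^sub>R y" "- x"] sublinear_scaleR[OF p, of t y] by simp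
  qed
qed (use assms in simp)

lemma le_tiltI:
  assumes "\<And>t. 0 \<le> t \<Longrightarrow> c \<le> p (x + t *\<^sub>R y) - t * p y"
  shows "c \<le> tilt p y x"
  unfolding tilt_def using assms by (intro cINF_greatest) auto

lemma tilt_le_self: "tilt p y x \<le> p x"
  using tilt_le[of 0 x] by simp

lemma tilt_uminus_le: "tilt p y (- y) \<le> - p y"
  using tilt_le[of 1 "- y"] sublinear_zero[OF p] by simp

lemma sublinear_tilt: "sublinear (tilt p y)"
proof (rule sublinearI)
  fix u v
  have "tilt p y (u + v) - (p (u + s *\<^sub>R y) - s * p y) \<le> p (v + t *\<^sub>R y) - t * p y"
    if "0 \<le> s" "0 \<le> t" for s t
    using tilt_le[of "s + t" "u + v"] sublinear_add[OF p, of "u + s *\<^sub>R y" "v + t *\<^sub>R y"] that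
    by (simp add: algebra_simps)
  then have "tilt p y (u + v) - (p (u + s *\<^sub>R y) - s * p y) \<le> tilt p y v" if "0 \<le> s" for s
    using that by (intro le_tiltI) simp
  then have "tilt p y (u + v) - tilt p y v \<le> tilt p y u"
    by (intro le_tiltI) (simp add: algebra_simps)
  then show "tilt p y (u + v) \<le> tilt p y u + tilt p y v" by simp
next
  show "tilt p y 0 \<le> 0" using tilt_le_self[of 0] sublinear_zero[OF p] by simp
next
  fix r :: real and x assume r: "0 < r"
  have "tilt p y (r *\<^sub>R x) / r \<le> p (x + t *\<^sub>R y) - t * p y" if "0 \<le> t" for t
  proof -
    have "tilt p y (r *\<^sub>R x) \<le> r * (p (x + t *\<^sub>R y) - t * p y)"
      using tilt_le[of "r * t" "r *\<^sub>R x"] sublinear_scaleR[OF p, of r "x + t *\<^sub>R y"] r that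
      by (simp add: algebra_simps)
    then show ?thesis using r by (simp add: divide_le_eq mult.commute)
  qed
  then have "tilt p y (r *\<^sub>R x) / r \<le> tilt p y x" by (rule le_tiltI)
  then show "tilt p y (r *\<^sub>R x) \<le> r * tilt p y x" using r by (simp add: field_simps)
qed

end

text \<open>
  Minimality gives \<open>tilt q y = q\<close>. Taking \<open>t = 1\<close> in the infimum then yields
  \<open>q x + q y \<le> q (x + y)\<close>, the inequality that sublinearity lacks.
\<close>

lemma linear_if_minimal_sublinear:
  assumes q: "sublinear q"
    and minimal: "\<And>q'. sublinear q' \<Longrightarrow> (\<And>x. q' x \<le> q x) \<Longrightarrow> q' = q"
  shows "linear q"
proof -
  have add: "q (x + y) = q x + q y" for x y
  proof -
    have "tilt q y = q"
      by (rule minimal) (simp_all add: sublinear_tilt tilt_le_self q)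
    then have "q x \<le> q (x + y) - q y"
      using tilt_le[OF q, of 1 y x] by simp
    with sublinear_add[OF q, of x y] show ?thesis by simp
  qed
  have "q (- x) = - q x" for x
    using add[of x "- x"] sublinear_zero[OF q] by simp
  then have "q (r *\<^sub>R x) = r * q x" for r x
    using sublinear_scaleR[OF q, of r x] sublinear_scaleR[OF q, of "- r" x]
    by (cases "0 \<le> r") simp_all
  with add show ?thesis by (intro linearI) simp_all
qed

text \<open>
  The Hahn--Banach theorem in its analytic form, by Zorn's lemma: the pointwise infimum of a chain of
  sublinear functionals below \<open>p\<close> is again one, so there is a minimal one, and that one is linear.
\<close>

theorem sublinear_dominates_linear:
  fixes p :: "'a::real_vector \<Rightarrow> real"
  assumes p: "sublinear p"
  obtains u where "linear u" "\<And>x. u x \<le> p x"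
proof -
  define S where "S = {q. sublinear q \<and> (\<forall>x. q x \<le> p x)}"
  define R where "R = relation_of (\<lambda>q q'. \<forall>x. q' x \<le> (q x :: real)) S"
  have "\<exists>m\<in>S. \<forall>q\<in>S. (\<forall>x. q x \<le> m x) \<longrightarrow> q = m"
  proof (rule predicate_Zorn)
    show "partial_order_on S (relation_of (\<lambda>q q'. \<forall>x. q' x \<le> (q x :: real)) S)"
      by (rule partial_order_on_relation_ofI) (auto intro: order_trans simp: fun_eq_iff order_eq_iff)
  next
    fix C assume C: "C \<in> Chains (relation_of (\<lambda>q q'. \<forall>x. q' x \<le> (q x :: real)) S)"
    have CS: "q \<in> S" if "q \<in> C" for q
      using C that by (auto simp: Chains_def relation_of_def)
    have total: "(\<forall>x. q' x \<le> q x) \<or> (\<forall>x. q x \<le> q' x)" if "q \<in> C" "q' \<in> C" for q q'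
      using C that by (auto simp: Chains_def relation_of_def)
    show "\<exists>m\<in>S. \<forall>q\<in>C. \<forall>x. m x \<le> q x"
    proof (cases "C = {}")
      case True
      then show ?thesis using p by (auto simp: S_def)
    next
      case False
      define m where "m x = (INF q\<in>C. q x)" for x
      have lower: "m x \<le> q x" if "q \<in> C" for q x
        unfolding m_def
      proof (rule cINF_lower)
        show "bdd_below ((\<lambda>q. q x) ` C)"
        proof (rule bdd_belowI2)
          fix q assume "q \<in> C"
          then have "sublinear q" "q (- x) \<le> p (- x)" using CS by (auto simp: S_def)
          \<comment> \<open>The infimum is finite because a sublinear functional below \<open>p\<close> is also bounded below.\<close>
          then show "- p (- x) \<le> q x" using sublinear_ge_uminus[of q x] by simp
        qed
      qed (rule that)
      have greatest: "c \<le> m x" if "\<And>q. q \<in> C \<Longrightarrow> c \<le> q x" for c x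
        unfolding m_def using that False by (intro cINF_greatest) auto
      obtain q0 where q0: "q0 \<in> C" using False by auto
      have "sublinear m"
      proof (rule sublinearI)
        fix x y
        \<comment> \<open>Comparability enters here: the smaller of the two functionals bounds both summands.\<close>
        have both: "m (x + y) \<le> q x + q' y" if q: "q \<in> C" "q' \<in> C" for q q'
          using total[OF q] lower[OF q(1), of "x + y"] lower[OF q(2), of "x + y"]
            sublinear_add[of q x y] sublinear_add[of q' x y] CS[OF q(1)] CS[OF q(2)]
          unfolding S_def by (smt (verit) mem_Collect_eq)
        have "m (x + y) - q x \<le> m y" if "q \<in> C" for q
          using both[OF that] by (intro greatest) (simp add: algebra_simps)
        then have "m (x + y) - m y \<le> m x"
          by (intro greatest) (simp add: algebra_simps)
        then show "m (x + y) \<le> m x + m y" by simp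
      next
        show "m 0 \<le> 0" using lower[OF q0, of 0] CS[OF q0] sublinear_zero[of q0] by (auto simp: S_def)
      next
        fix r :: real and x assume r: "0 < r"
        have "m (r *\<^sub>R x) / r \<le> m x"
        proof (rule greatest)
          fix q assume q: "q \<in> C"
          show "m (r *\<^sub>R x) / r \<le> q x"
            using lower[OF q, of "r *\<^sub>R x"] sublinear_scaleR[of q r x] CS[OF q] r
            by (simp add: S_def field_simps)
        qed
        then show "m (r *\<^sub>R x) \<le> r * m x" using r by (simp add: field_simps)
      qed
      moreover have "m x \<le> p x" for x
        using lower[OF q0, of x] CS[OF q0] by (auto simp: S_def intro: order_trans)
      ultimately show ?thesis using lower by (auto simp: S_def)
    qed
  qed
  then obtain m where m: "m \<in> S" and min: "\<And>q. q \<in> S \<Longrightarrow> (\<forall>x. q x \<le> m x) \<Longrightarrow> q = m"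
    by blast
  have "linear m"
  proof (rule linear_if_minimal_sublinear)
    show "sublinear m" using m by (simp add: S_def)
    fix q assume "sublinear q" "\<And>x. q x \<le> m x"
    then show "q = m" using m by (intro min) (auto simp: S_def intro: order_trans)
  qed
  with m that show thesis by (auto simp: S_def)
qed

lemma sublinear_norm: "sublinear (norm :: 'a::real_normed_vector \<Rightarrow> real)"
  by (simp add: sublinear_def norm_triangle_ineq)

lemma exists_real_norming_functional:
  fixes v :: "'a::real_normed_vector"
  obtains u :: "'a \<Rightarrow> real" where "linear u" "\<And>x. \<bar>u x\<bar> \<le> norm x" "u v = norm v"
proof -
  obtain u where u: "linear u" and le: "\<And>x. u x \<le> tilt norm v x"
    using sublinear_dominates_linear[OF sublinear_tilt[OF sublinear_norm]] by blast
  have le_norm: "u x \<le> norm x" for x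
    using le[of x] tilt_le_self[OF sublinear_norm, of v x] by simp
  have "\<bar>u x\<bar> \<le> norm x" for x
    using le_norm[of x] le_norm[of "- x"] linear_neg[OF u] by simp
  moreover have "norm v \<le> u v"
    using le[of "- v"] tilt_uminus_le[OF sublinear_norm, of v] linear_neg[OF u, of v] by simp
  ultimately show thesis using that[OF u] le_norm[of v] by simp
qed

text \<open>
  The usual complexification \<open>u x - \<i> u (\<i> x)\<close> of a real norming functional \<open>u\<close>. The crude factor
  \<open>2\<close> comes from adding the bounds for the real and the imaginary part; it only affects constants.
\<close>

lemma exists_complex_functional:
  fixes v :: "'a::complex_normed_vector"
  obtains l :: "'a \<Rightarrow> complex"
  where "bounded_linear l" "\<And>c x. l (c *\<^sub>C x) = c * l x"
    "\<And>x. cmod (l x) \<le> 2 * norm x" "norm v \<le> cmod (l v)"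
proof -
  obtain u :: "'a \<Rightarrow> real" where u: "linear u" "\<And>x. \<bar>u x\<bar> \<le> norm x" "u v = norm v"
    using exists_real_norming_functional by blast
  define l where "l x = Complex (u x) (- u (\<i> *\<^sub>C x))" for x
  have bound: "cmod (l x) \<le> 2 * norm x" for x
    using cmod_le[of "l x"] u(2)[of x] u(2)[of "\<i> *\<^sub>C x"] by (simp add: l_def norm_scaleC)
  have decompose: "c *\<^sub>C x = Re c *\<^sub>R x + Im c *\<^sub>R (\<i> *\<^sub>C x)" for c and x :: 'a
  proof -
    have "c *\<^sub>C x = (complex_of_real (Re c) + complex_of_real (Im c) * \<i>) *\<^sub>C x"
      by (metis complex_eq mult.commute)
    then show ?thesis
      by (simp add: scaleC_add_left scaleC_of_real flip: scaleC_scaleC)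
  qed
  have uC: "u (c *\<^sub>C x) = Re c * u x + Im c * u (\<i> *\<^sub>C x)" for c x
    by (subst decompose) (simp add: linear_add[OF u(1)] linear_scale[OF u(1)])
  have homogeneous: "l (c *\<^sub>C x) = c * l x" for c x
    unfolding l_def scaleC_scaleC uC[of c x] uC[of "\<i> * c" x]
    by (simp add: complex_eq_iff)
  have "bounded_linear l"
  proof (rule bounded_linear_intro)
    show "l (x + y) = l x + l y" for x y
      by (simp add: l_def scaleC_add_right linear_add[OF u(1)] complex_eq_iff)
    show "l (r *\<^sub>R x) = r *\<^sub>R l x" for r x
      using homogeneous[of "complex_of_real r" x] by (simp add: scaleC_of_real scaleR_conv_of_real)
    show "norm (l x) \<le> norm x * 2" for x using bound[of x] by simp
  qed
  moreover have "norm v \<le> cmod (l v)"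
    using abs_Re_le_cmod[of "l v"] u(3) by (simp add: l_def)
  ultimately show thesis using that homogeneous bound by blast
qed

section \<open>Cauchy's estimate for vector-valued functions\<close>

lemma has_cderiv_cderiv:
  assumes "f \<in> analytic_disc" "z \<in> unit_disc"
  shows "has_cderiv f (cderiv f z) z"
  using assms has_cderiv_imp_cderiv unfolding analytic_disc_def by blast

lemma analytic_discI:
  assumes "\<And>z. z \<in> unit_disc \<Longrightarrow> has_cderiv f (D z) z"
  shows "f \<in> analytic_disc"
  using assms unfolding analytic_disc_def by blast

text \<open>
  Cauchy's estimate for vector-valued functions, obtained from the scalar one for \<open>l \<circ> f\<close>, where
  \<open>l\<close> is a functional with \<open>norm (cderiv f z) \<le> \<bar>l (cderiv f z)\<bar>\<close>. The factor \<open>2\<close> is the bound for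
  the norm of \<open>l\<close>.
\<close>

lemma norm_cderiv_le_Cauchy:
  fixes f :: "complex \<Rightarrow> 'a::complex_normed_vector"
  assumes "0 < r"
    and diff: "\<And>w. w \<in> cball z r \<Longrightarrow> \<exists>D. has_cderiv f D w"
    and bound: "\<And>w. dist z w = r \<Longrightarrow> norm (f w - f z) \<le> B"
  shows "norm (cderiv f z) \<le> 2 * B / r"
proof -
  obtain l :: "'a \<Rightarrow> complex" where l: "bounded_linear l" "\<And>c x. l (c *\<^sub>C x) = c * l x"
    "\<And>x. cmod (l x) \<le> 2 * norm x" "norm (cderiv f z) \<le> cmod (l (cderiv f z))"
    using exists_complex_functional by blast
  define g where "g w = l (f w - f z)" for w
  have deriv_g: "(g has_field_derivative l (cderiv f w)) (at w)" if "w \<in> cball z r" for w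
  proof -
    have "has_cderiv f (cderiv f w) w" using diff[OF that] has_cderiv_imp_cderiv by blast
    then have "((\<lambda>w. f w - f z) has_derivative (\<lambda>h. h *\<^sub>C cderiv f w)) (at w)"
      unfolding has_cderiv_def by (auto intro!: derivative_eq_intros)
    from bounded_linear.has_derivative[OF l(1) this] show ?thesis
      by (simp add: g_def[abs_def] l(2) has_field_derivative_def mult.commute[of _ "l (cderiv f w)"])
  qed
  have "norm ((deriv ^^ 1) g z) \<le> fact 1 * (2 * B) / r ^ 1"
  proof (rule Cauchy_inequality)
    show "g holomorphic_on ball z r"
      unfolding holomorphic_on_open[OF open_ball] using deriv_g ball_subset_cball by blast
    show "continuous_on (cball z r) g"
      by (rule DERIV_continuous_on) (use deriv_g in \<open>blast intro: has_field_derivative_at_within\<close>)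
    show "norm (g w) \<le> 2 * B" if "norm (z - w) = r" for w
      using l(3)[of "f w - f z"] bound[of w] that by (simp add: g_def dist_norm)
  qed fact
  then have "norm (deriv g z) \<le> 2 * B / r" by simp
  moreover have "deriv g z = l (cderiv f z)"
    using deriv_g[of z] \<open>0 < r\<close> by (intro DERIV_imp_deriv) simp
  ultimately show ?thesis using l(4) by simp
qed

section \<open>Hoelder continuity and growth of the derivative\<close>

lemma one_minus_cmod_square_pos:
  assumes "z \<in> unit_disc"
  shows "0 < 1 - (cmod z)\<^sup>2"
  using assms by (simp add: power_less_one_iff abs_square_less_1)

lemma weight_zero: "z \<in> unit_disc \<Longrightarrow> weight 0 z = 1"
  using one_minus_cmod_square_pos[of z] by (simp add: weight_def)

lemma weight_nonneg: "0 \<le> weight \<gamma> z"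
  by (simp add: weight_def)

text \<open>
  Suprema of real sets carry information only for nonempty bounded sets; a nonnegative member also
  makes the supremum nonnegative.
\<close>

lemma holder_quotients_nonempty: "\<exists>q \<in> holder_quotients \<alpha> f. 0 \<le> q"
proof -
  have "norm (f 0 - f (1/2)) / cmod (0 - 1/2) powr \<alpha> \<in> holder_quotients \<alpha> f"
    unfolding holder_quotients_def by (intro CollectI exI[of _ 0] exI[of _ "1/2"]) auto
  then show ?thesis by (rule bexI[rotated]) simp
qed

lemma Sup_holder_quotients_nonneg:
  assumes "f \<in> lip_space \<alpha>"
  shows "0 \<le> Sup (holder_quotients \<alpha> f)"
  using holder_quotients_nonempty[of \<alpha> f] assms cSup_upper2[of _ "holder_quotients \<alpha> f" 0]
  by (auto simp: lip_space_def)

lemma lip_space_norm_diff_le: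
  assumes "f \<in> lip_space \<alpha>" "z \<in> unit_disc" "w \<in> unit_disc"
  shows "norm (f z - f w) \<le> Sup (holder_quotients \<alpha> f) * cmod (z - w) powr \<alpha>"
proof (cases "z = w")
  case False
  have "norm (f z - f w) / cmod (z - w) powr \<alpha> \<le> Sup (holder_quotients \<alpha> f)"
    using assms False by (intro cSup_upper) (auto simp: lip_space_def holder_quotients_def)
  moreover have "0 < cmod (z - w) powr \<alpha>" using False by simp
  ultimately show ?thesis by (simp add: divide_le_eq)
qed simp

text \<open>
  On the circle of radius \<open>r = (1 - \<bar>z\<bar>) / 2\<close> about \<open>z\<close> the function differs from \<open>f z\<close> by at most a
  multiple of \<open>r powr \<alpha>\<close>, so Cauchy's estimate gives \<open>norm (cderiv f z) \<le> c * r powr (\<alpha> - 1)\<close>, and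
  \<open>1 - \<bar>z\<bar>\<^sup>2 \<le> 4 * r\<close> turns the power of \<open>r\<close> into the weight.
\<close>

lemma lip_space_weighted_cderiv_le:
  assumes f: "f \<in> lip_space \<alpha>" and \<alpha>: "0 < \<alpha>" "\<alpha> \<le> 1" and z: "z \<in> unit_disc"
  shows "weight (1 - \<alpha>) z * norm (cderiv f z) \<le> 8 * Sup (holder_quotients \<alpha> f)"
proof -
  define K where "K = Sup (holder_quotients \<alpha> f)"
  define r where "r = (1 - cmod z) / 2"
  have K: "0 \<le> K" using Sup_holder_quotients_nonneg[OF f] by (simp add: K_def)
  have r: "0 < r" using z by (simp add: r_def)
  have sub: "cball z r \<subseteq> unit_disc"
  proof
    fix w assume "w \<in> cball z r"
    then have "cmod w \<le> cmod z + r"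
      using norm_triangle_ineq2[of w z] by (simp add: dist_norm norm_minus_commute)
    then show "w \<in> unit_disc" using z by (simp add: r_def field_simps)
  qed
  have "norm (cderiv f z) \<le> 2 * (K * r powr \<alpha>) / r"
  proof (rule norm_cderiv_le_Cauchy[OF r])
    show "\<exists>D. has_cderiv f D w" if "w \<in> cball z r" for w
      using that sub f has_cderiv_cderiv unfolding lip_space_def by blast
    show "norm (f w - f z) \<le> K * r powr \<alpha>" if "dist z w = r" for w
    proof -
      have "w \<in> unit_disc" using that sub by auto
      from lip_space_norm_diff_le[OF f this z] that show ?thesis
        by (simp add: K_def dist_norm norm_minus_commute)
    qed
  qed
  also have "\<dots> = 2 * K * r powr (\<alpha> - 1)"
    using r by (simp add: powr_diff)
  finally have D: "norm (cderiv f z) \<le> 2 * K * r powr (\<alpha> - 1)" .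
  have "1 - (cmod z)\<^sup>2 = (1 + cmod z) * (2 * r)"
    by (simp add: r_def power2_eq_square algebra_simps)
  also have "\<dots> \<le> 2 * (2 * r)"
    using z r by (intro mult_right_mono) auto
  finally have "weight (1 - \<alpha>) z \<le> (4 * r) powr (1 - \<alpha>)"
    unfolding weight_def using \<alpha> one_minus_cmod_square_pos[OF z] by (intro powr_mono2) auto
  also have "\<dots> = 4 powr (1 - \<alpha>) * r powr (1 - \<alpha>)"
    using r by (simp add: powr_mult)
  also have "\<dots> \<le> 4 * r powr (1 - \<alpha>)"
    using \<alpha> powr_mono[of "1 - \<alpha>" 1 4] by (intro mult_right_mono) auto
  finally have "weight (1 - \<alpha>) z * norm (cderiv f z)
      \<le> (4 * r powr (1 - \<alpha>)) * (2 * K * r powr (\<alpha> - 1))"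
    using D weight_nonneg by (intro mult_mono) auto
  also have "\<dots> = 8 * K * (r powr (1 - \<alpha>) * r powr (\<alpha> - 1))" by simp
  also have "r powr (1 - \<alpha>) * r powr (\<alpha> - 1) = 1"
    using r by (simp flip: powr_add)
  finally show ?thesis by (simp add: K_def)
qed

text \<open>
  Along a segment from \<open>z\<close> to a point \<open>m\<close> at depth at least \<open>s\<close>, convexity of the modulus puts the
  point with parameter \<open>t\<close> at depth at least \<open>t * s\<close>. The derivative there is at most
  \<open>M * (t * s) powr (\<beta> - 1)\<close>, which is integrable at \<open>t = 0\<close> since \<open>\<beta> > 0\<close>; this is where the
  divisor \<open>\<beta>\<close> arises. The factor \<open>3\<close> is what the application below requires.
\<close>

lemma norm_diff_le_inward:
  fixes f :: "complex \<Rightarrow> 'a::complex_banach"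
  assumes f: "f \<in> analytic_disc" and \<beta>: "0 < \<beta>" "\<beta> \<le> 1"
    and M: "\<And>z. z \<in> unit_disc \<Longrightarrow> weight (1 - \<beta>) z * norm (cderiv f z) \<le> M"
    and z: "z \<in> unit_disc" and s: "0 < s" "s \<le> 1 - cmod m" and zm: "cmod (z - m) \<le> 3 * s"
  shows "norm (f m - f z) \<le> 3 * M / \<beta> * s powr \<beta>"
proof -
  define \<gamma> where "\<gamma> t = z + t *\<^sub>R (m - z)" for t :: real
  \<comment> \<open>The primitive of the bound for the speed of \<open>f \<circ> \<gamma>\<close>, to be used in the mean value inequality.\<close>
  define \<Phi> where "\<Phi> t = 3 * M / \<beta> * s powr \<beta> * t powr \<beta>" for t :: real
  have \<gamma>_le: "cmod (\<gamma> t) \<le> (1 - t) * cmod z + t * (1 - s)" if "0 \<le> t" "t \<le> 1" for t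
  proof -
    have "\<gamma> t = (1 - t) *\<^sub>R z + t *\<^sub>R m" by (simp add: \<gamma>_def algebra_simps)
    then have "cmod (\<gamma> t) \<le> (1 - t) * cmod z + t * cmod m"
      using norm_triangle_ineq[of "(1 - t) *\<^sub>R z" "t *\<^sub>R m"] that by simp
    also have "\<dots> \<le> (1 - t) * cmod z + t * (1 - s)"
      using s that by (intro add_left_mono mult_left_mono) auto
    finally show ?thesis .
  qed
  have \<gamma>_in: "\<gamma> t \<in> unit_disc" if t: "0 \<le> t" "t \<le> 1" for t
  proof (cases "t = 0")
    case False
    have "(1 - t) * cmod z \<le> 1 - t" using z t by (intro mult_left_le) auto
    moreover have "t * (1 - s) < t" using t s False by simp
    ultimately show ?thesis using \<gamma>_le[OF t] by simp
  qed (use z in \<open>simp add: \<gamma>_def\<close>)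
  have deriv: "((\<lambda>t. f (\<gamma> t)) has_vector_derivative (m - z) *\<^sub>C cderiv f (\<gamma> t)) (at t)"
    if "0 \<le> t" "t \<le> 1" for t
  proof -
    have "(\<gamma> has_derivative (\<lambda>h. h *\<^sub>R (m - z))) (at t)"
      unfolding \<gamma>_def[abs_def] by (auto intro!: derivative_eq_intros)
    from has_derivative_compose[OF this has_cderiv_cderiv[OF f \<gamma>_in[OF that], unfolded has_cderiv_def]]
    show ?thesis
      by (simp add: has_vector_derivative_def bounded_bilinear.scaleR_left[OF bounded_bilinear_scaleC])
  qed
  have "norm (f (\<gamma> 1) - f (\<gamma> 0)) \<le> \<Phi> 1 - \<Phi> 0"
  proof (rule differentiable_bound_general[where f = "\<lambda>t. f (\<gamma> t)"])
    show "continuous_on {0..1} (\<lambda>t. f (\<gamma> t))"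
      using deriv by (intro continuous_at_imp_continuous_on ballI has_vector_derivative_continuous) auto
    show "continuous_on {0..1} \<Phi>"
      unfolding \<Phi>_def[abs_def] using \<beta> by (intro continuous_intros continuous_on_powr') auto
    fix t :: real assume t: "0 < t" "t < 1"
    show "((\<lambda>t. f (\<gamma> t)) has_vector_derivative (m - z) *\<^sub>C cderiv f (\<gamma> t)) (at t)"
      using deriv t by simp
    show "(\<Phi> has_vector_derivative 3 * M * s powr \<beta> * t powr (\<beta> - 1)) (at t)"
      unfolding \<Phi>_def[abs_def] has_real_derivative_iff_has_vector_derivative[symmetric]
      using t \<beta> by (auto intro!: derivative_eq_intros simp: powr_diff field_simps)
    have in_disc: "\<gamma> t \<in> unit_disc" using \<gamma>_in t by simp
    have "(1 - t) * cmod z \<le> 1 - t" using z t by (intro mult_left_le) auto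
    then have "t * s \<le> 1 - cmod (\<gamma> t)" using \<gamma>_le[of t] t by (simp add: algebra_simps)
    also have "\<dots> \<le> 1 - (cmod (\<gamma> t))\<^sup>2"
      using in_disc by (simp add: power2_eq_square mult_left_le)
    finally have "(t * s) powr (1 - \<beta>) \<le> weight (1 - \<beta>) (\<gamma> t)"
      unfolding weight_def using t s \<beta> by (intro powr_mono2) auto
    then have "(t * s) powr (1 - \<beta>) * norm (cderiv f (\<gamma> t)) \<le> M"
      using M[OF in_disc] by (meson mult_right_mono norm_ge_zero order_trans)
    then have "norm (cderiv f (\<gamma> t)) \<le> M / (t * s) powr (1 - \<beta>)"
      using t s by (simp add: pos_le_divide_eq mult.commute)
    then have "norm ((m - z) *\<^sub>C cderiv f (\<gamma> t)) \<le> (3 * s) * (M / (t * s) powr (1 - \<beta>))"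
      unfolding norm_scaleC using zm s by (intro mult_mono) (auto simp: norm_minus_commute)
    also have "\<dots> = 3 * M * s powr \<beta> * t powr (\<beta> - 1)"
      using t s by (simp add: powr_mult powr_diff field_simps)
    finally show "norm ((m - z) *\<^sub>C cderiv f (\<gamma> t)) \<le> 3 * M * s powr \<beta> * t powr (\<beta> - 1)" .
  qed simp
  then show ?thesis using \<beta> by (simp add: \<gamma>_def \<Phi>_def)
qed

text \<open>
  The straight segment from \<open>z\<close> to \<open>w\<close> may stay within \<open>\<bar>z - w\<bar>\<^sup>2\<close> of the unit circle, too close
  for the bound on the derivative to be useful. So the path goes through the radial contraction
  \<open>m\<close> of \<open>z\<close>, which has depth at least \<open>s = \<bar>z - w\<bar> / 2\<close> and lies within \<open>3 * s\<close> of both points.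
\<close>

lemma norm_diff_le_powr:
  fixes f :: "complex \<Rightarrow> 'a::complex_banach"
  assumes f: "f \<in> analytic_disc" and \<beta>: "0 < \<beta>" "\<beta> \<le> 1"
    and M: "\<And>z. z \<in> unit_disc \<Longrightarrow> weight (1 - \<beta>) z * norm (cderiv f z) \<le> M"
    and z: "z \<in> unit_disc" and w: "w \<in> unit_disc"
  shows "norm (f z - f w) \<le> 6 * M / \<beta> * cmod (z - w) powr \<beta>"
proof (cases "z = w")
  case False
  define s where "s = cmod (z - w) / 2"
  define m where "m = (1 - s) *\<^sub>R z"
  have s: "0 < s" "s < 1"
    using False norm_triangle_ineq4[of z w] z w by (auto simp: s_def)
  have "cmod m \<le> (1 - s) * 1"
    unfolding m_def norm_scaleR using s z by (intro mult_mono) auto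
  then have sm: "s \<le> 1 - cmod m" by simp
  have zm: "cmod (z - m) \<le> s"
    using s z mult_left_le[of "cmod z" s] by (simp add: m_def algebra_simps)
  have "cmod (w - m) \<le> cmod (w - z) + cmod (z - m)"
    using norm_triangle_ineq[of "w - z" "z - m"] by simp
  then have wm: "cmod (w - m) \<le> 3 * s"
    using zm by (simp add: s_def norm_minus_commute)
  have "norm (f z - f w) \<le> norm (f m - f z) + norm (f m - f w)"
    using norm_triangle_ineq4[of "f m - f w" "f m - f z"] by simp
  also have "\<dots> \<le> 3 * M / \<beta> * s powr \<beta> + 3 * M / \<beta> * s powr \<beta>"
    using s sm zm wm z w by (intro add_mono norm_diff_le_inward[OF f \<beta> M]) auto
  also have "\<dots> = 6 * M / \<beta> * s powr \<beta>" by simp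
  also have "\<dots> \<le> 6 * M / \<beta> * cmod (z - w) powr \<beta>"
  proof (rule mult_left_mono)
    show "s powr \<beta> \<le> cmod (z - w) powr \<beta>"
      using \<beta> by (intro powr_mono2) (auto simp: s_def)
    have "0 \<le> M" using M[OF z] weight_nonneg[of "1 - \<beta>" z]
      by (meson mult_nonneg_nonneg norm_ge_zero order_trans)
    then show "0 \<le> 6 * M / \<beta>" using \<beta> by simp
  qed
  finally show ?thesis .
qed simp

text \<open>
  For \<open>\<beta> < 1\<close> the estimate of the norm is immediate from the definition, with constant \<open>1\<close>. For
  \<open>\<beta> = 1\<close> the supremum of \<open>f\<close> and its Lipschitz constant each contribute \<open>6 * M\<close>; the constant
  \<open>12\<close> covers both cases.
\<close>

lemma lip_space_if_weighted_cderiv_le: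
  fixes f :: "complex \<Rightarrow> 'a::complex_banach"
  assumes f: "f \<in> analytic_disc" and \<beta>: "0 < \<beta>" "\<beta> \<le> 1"
    and M: "\<And>z. z \<in> unit_disc \<Longrightarrow> weight (1 - \<beta>) z * norm (cderiv f z) \<le> M"
  shows "f \<in> lip_space \<beta>" and "lip_norm \<beta> f \<le> norm (f 0) + 12 * M"
proof -
  have quotient: "q \<le> 6 * M / \<beta>" if q: "q \<in> holder_quotients \<beta> f" for q
  proof -
    obtain z w where zw: "q = norm (f z - f w) / cmod (z - w) powr \<beta>"
      "z \<in> unit_disc" "w \<in> unit_disc" "z \<noteq> w"
      using q unfolding holder_quotients_def by blast
    have "norm (f z - f w) \<le> 6 * M / \<beta> * cmod (z - w) powr \<beta>"
      using M zw(2,3) by (rule norm_diff_le_powr[OF f \<beta>])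
    then show ?thesis using zw(1,4) by (simp add: pos_divide_le_eq)
  qed
  then have "bdd_above (holder_quotients \<beta> f)" by (rule bdd_aboveI)
  with f show "f \<in> lip_space \<beta>" by (simp add: lip_space_def)
  have M0: "0 \<le> M" using M[of 0] weight_nonneg[of "1 - \<beta>" 0]
    by (meson centre_in_ball mult_nonneg_nonneg norm_ge_zero order_trans zero_less_one)
  show "lip_norm \<beta> f \<le> norm (f 0) + 12 * M"
  proof (cases "\<beta> = 1")
    case True
    have "norm (f z) \<le> norm (f 0) + 6 * M" if z: "z \<in> unit_disc" for z
    proof -
      have "norm (f z) \<le> norm (f 0) + norm (f z - f 0)"
        using norm_triangle_ineq[of "f 0" "f z - f 0"] by simp
      also have "norm (f z - f 0) \<le> 6 * M * cmod z"
        using norm_diff_le_powr[OF f \<beta> M z, of 0] True by simp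
      also have "\<dots> \<le> 6 * M" using M0 z by (intro mult_left_le) auto
      finally show ?thesis by simp
    qed
    then have "(SUP z\<in>unit_disc. norm (f z)) \<le> norm (f 0) + 6 * M"
      by (intro cSUP_least) auto
    moreover have "Sup (holder_quotients 1 f) \<le> 6 * M"
      using quotient holder_quotients_nonempty[of 1 f] True by (intro cSup_least) auto
    ultimately show ?thesis using True by (simp add: lip_norm_def)
  next
    case False
    have "(SUP z\<in>unit_disc. weight (1 - \<beta>) z * norm (cderiv f z)) \<le> M"
      using M by (intro cSUP_least) auto
    with False M0 show ?thesis by (simp add: lip_norm_def)
  qed
qed

lemma lip_space_one_bounded:
  assumes f: "f \<in> lip_space 1"
  shows "bdd_above ((\<lambda>z. norm (f z)) ` unit_disc)"
proof (rule bdd_aboveI2)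
  fix z assume z: "z \<in> unit_disc"
  have "norm (f z) \<le> norm (f 0) + norm (f z - f 0)"
    using norm_triangle_ineq[of "f 0" "f z - f 0"] by simp
  also have "norm (f z - f 0) \<le> Sup (holder_quotients 1 f) * cmod z"
    using lip_space_norm_diff_le[OF f z, of 0] by simp
  also have "\<dots> \<le> Sup (holder_quotients 1 f)"
    using Sup_holder_quotients_nonneg[OF f] z by (intro mult_left_le) auto
  finally show "norm (f z) \<le> norm (f 0) + Sup (holder_quotients 1 f)" by simp
qed

lemma norm_le_lip_norm_one:
  assumes f: "f \<in> lip_space 1" and z: "z \<in> unit_disc"
  shows "norm (f z) \<le> lip_norm 1 f"
  using cSUP_upper[OF z lip_space_one_bounded[OF f]] Sup_holder_quotients_nonneg[OF f]
  by (simp add: lip_norm_def)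

text \<open>
  For \<open>\<beta> < 1\<close> the weighted derivative occurs in the definition of the norm, but a supremum bounds its
  members only once the set is known to be bounded; this is what Cauchy's estimate provides. For
  \<open>\<beta> = 1\<close> the estimate itself gives the bound, with the factor \<open>8\<close>.
\<close>

lemma weighted_cderiv_le_lip_norm:
  assumes f: "f \<in> lip_space \<beta>" and \<beta>: "0 < \<beta>" "\<beta> \<le> 1" and z: "z \<in> unit_disc"
  shows "weight (1 - \<beta>) z * norm (cderiv f z) \<le> 8 * lip_norm \<beta> f"
proof (cases "\<beta> = 1")
  case True
  have "0 \<le> (SUP z\<in>unit_disc. norm (f z))"
    using cSUP_upper2[OF lip_space_one_bounded z, of f 0] f True by simp
  with lip_space_weighted_cderiv_le[OF f \<beta> z] True show ?thesis
    by (simp add: lip_norm_def)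
next
  case False
  define S where "S = (SUP z\<in>unit_disc. weight (1 - \<beta>) z * norm (cderiv f z))"
  have "bdd_above ((\<lambda>z. weight (1 - \<beta>) z * norm (cderiv f z)) ` unit_disc)"
    using lip_space_weighted_cderiv_le[OF f \<beta>] by (intro bdd_aboveI2)
  then have le: "weight (1 - \<beta>) z * norm (cderiv f z) \<le> S"
    unfolding S_def using z by (rule cSUP_upper[rotated])
  have "0 \<le> weight (1 - \<beta>) z * norm (cderiv f z)" using weight_nonneg by simp
  with le have "weight (1 - \<beta>) z * norm (cderiv f z) \<le> 8 * (norm (f 0) + S)"
    by (smt (verit) norm_ge_zero)
  with False show ?thesis by (simp add: lip_norm_def S_def)
qed

lemma norm_zero_le_lip_norm:
  assumes f: "f \<in> lip_space \<beta>" and \<beta>: "0 < \<beta>" "\<beta> \<le> 1"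
  shows "norm (f 0) \<le> lip_norm \<beta> f"
proof (cases "\<beta> = 1")
  case True
  then show ?thesis using norm_le_lip_norm_one[of f 0] f by simp
next
  case False
  have "bdd_above ((\<lambda>z. weight (1 - \<beta>) z * norm (cderiv f z)) ` unit_disc)"
    using lip_space_weighted_cderiv_le[OF f \<beta>] by (intro bdd_aboveI2)
  from cSUP_upper2[OF this, of 0 0] weight_nonneg[of "1 - \<beta>" 0]
  have "0 \<le> (SUP z\<in>unit_disc. weight (1 - \<beta>) z * norm (cderiv f z))" by simp
  with False show ?thesis by (simp add: lip_norm_def)
qed

section \<open>Operator-valued functions and test functions\<close>

lemma bounded_bilinear_cblinfun_apply:
  "bounded_bilinear (cblinfun_apply ::
    ('a::complex_normed_vector, 'b::complex_normed_vector) cblinfun \<Rightarrow> 'a \<Rightarrow> 'b)"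
proof
  fix S T :: "('a, 'b) cblinfun" and x y :: 'a and r :: real
  show "cblinfun_apply (S + T) x = cblinfun_apply S x + cblinfun_apply T x"
    by transfer (rule blinfun.add_left)
  show "cblinfun_apply T (x + y) = cblinfun_apply T x + cblinfun_apply T y"
    by transfer (rule blinfun.add_right)
  show "cblinfun_apply (r *\<^sub>R T) x = r *\<^sub>R cblinfun_apply T x"
    by transfer (rule blinfun.scaleR_left)
  show "cblinfun_apply T (r *\<^sub>R x) = r *\<^sub>R cblinfun_apply T x"
    by transfer (rule blinfun.scaleR_right)
  show "\<exists>K. \<forall>(T :: ('a, 'b) cblinfun) x. norm (cblinfun_apply T x) \<le> norm T * norm x * K"
    by (intro exI[of _ 1] allI) (transfer, simp add: norm_blinfun)
qed

lemma norm_cblinfun_apply_le: "norm (cblinfun_apply T x) \<le> norm T * norm x"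
  by transfer (rule norm_blinfun)

lemma norm_cblinfun_le:
  assumes "0 \<le> c" "\<And>x. norm (cblinfun_apply T x) \<le> c * norm x"
  shows "norm T \<le> c"
  using assms by transfer (rule norm_blinfun_bound)

lemma cblinfun_apply_scaleC_right: "cblinfun_apply T (c *\<^sub>C x) = c *\<^sub>C cblinfun_apply T x"
  by transfer simp

lemma cblinfun_apply_scaleC_left: "cblinfun_apply (c *\<^sub>C T) x = c *\<^sub>C cblinfun_apply T x"
  by transfer (simp add: blinfun_scaleC.rep_eq)

text \<open>
  Radius \<open>1/2\<close> is chosen because the test functions \<open>w \<mapsto> w x\<close> have norm up to \<open>2 * norm x\<close> and must
  stay in the unit ball. The factor \<open>s\<close> will be a weight.
\<close>

lemma norm_cblinfun_le_half_ball:
  fixes T :: "('a::complex_normed_vector, 'b::complex_normed_vector) cblinfun"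
  assumes "0 \<le> s" and bound: "\<And>x. norm x \<le> 1/2 \<Longrightarrow> s * norm (cblinfun_apply T x) \<le> c"
  shows "s * norm T \<le> 2 * c"
proof (cases "s = 0")
  case True
  then show ?thesis using bound[of 0] by simp
next
  case False
  with assms(1) have s: "0 < s" by simp
  have c: "0 \<le> c" using bound[of 0] by (simp add: bounded_bilinear.zero_right[OF bounded_bilinear_cblinfun_apply])
  have "norm T \<le> 2 * c / s"
  proof (rule norm_cblinfun_le)
    show "norm (cblinfun_apply T x) \<le> 2 * c / s * norm x" for x
    proof (cases "x = 0")
      case True
      then show ?thesis by (simp add: bounded_bilinear.zero_right[OF bounded_bilinear_cblinfun_apply])
    next
      case False
      have "s * norm (cblinfun_apply T ((1 / (2 * norm x)) *\<^sub>R x)) \<le> c"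
        using False by (intro bound) simp
      then show ?thesis using s False
        by (simp add: bounded_bilinear.scaleR_right[OF bounded_bilinear_cblinfun_apply] field_simps)
    qed
  qed (use s c in simp)
  then show ?thesis using s by (simp add: field_simps)
qed

lemma has_cderiv_wcomp:
  assumes \<psi>: "has_cderiv \<psi> A z" and \<phi>: "(\<phi> has_field_derivative d) (at z)"
    and f: "has_cderiv f E (\<phi> z)"
  shows "has_cderiv (wcomp \<psi> \<phi> f)
    (cblinfun_apply A (f (\<phi> z)) + cblinfun_apply (d *\<^sub>C \<psi> z) E) z"
proof -
  have "((\<lambda>z. f (\<phi> z)) has_derivative (\<lambda>h. (d * h) *\<^sub>C E)) (at z)"
    using has_derivative_compose[OF \<phi>[unfolded has_field_derivative_def] f[unfolded has_cderiv_def]] .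
  from bounded_bilinear.FDERIV[OF bounded_bilinear_cblinfun_apply \<psi>[unfolded has_cderiv_def] this]
  show ?thesis
    by (simp add: has_cderiv_def wcomp_def[abs_def] cblinfun_apply_scaleC_right
        cblinfun_apply_scaleC_left scaleC_scaleC scaleC_add_right mult.commute add.commute)
qed

lemma has_cderiv_scaleC:
  assumes \<psi>: "has_cderiv \<psi> A z" and g: "(g has_field_derivative d) (at z)"
  shows "has_cderiv (\<lambda>z. g z *\<^sub>C \<psi> z) (g z *\<^sub>C A + d *\<^sub>C \<psi> z) z"
  using bounded_bilinear.FDERIV[OF bounded_bilinear_scaleC g[unfolded has_field_derivative_def]
      \<psi>[unfolded has_cderiv_def]]
  by (simp add: has_cderiv_def scaleC_scaleC scaleC_add_right mult.commute)

lemma has_cderiv_apply: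
  assumes "has_cderiv \<psi> A z"
  shows "has_cderiv (\<lambda>z. cblinfun_apply (\<psi> z) x) (cblinfun_apply A x) z"
  using bounded_linear.has_derivative[OF
      bounded_bilinear.bounded_linear_left[OF bounded_bilinear_cblinfun_apply]
      assms[unfolded has_cderiv_def]]
  by (simp add: has_cderiv_def cblinfun_apply_scaleC_left)

lemma lip_space_const:
  fixes x :: "'a::complex_banach"
  shows "(\<lambda>_. x) \<in> lip_space 1" and "lip_norm 1 (\<lambda>_. x) = norm x"
proof -
  have quotients: "holder_quotients 1 (\<lambda>_. x) = {0}"
    using holder_quotients_nonempty[of 1 "\<lambda>_. x"] by (auto simp: holder_quotients_def)
  have "has_cderiv (\<lambda>_. x) 0 z" for z
    by (simp add: has_cderiv_def bounded_bilinear.zero_right[OF bounded_bilinear_scaleC])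
  then have "(\<lambda>_. x) \<in> analytic_disc" by (rule analytic_discI)
  then show "(\<lambda>_. x) \<in> lip_space 1"
    unfolding lip_space_def using quotients by simp
  show "lip_norm 1 (\<lambda>_. x) = norm x"
    by (simp add: lip_norm_def quotients)
qed

lemma has_cderiv_times_vector: "has_cderiv (\<lambda>w. w *\<^sub>C x) x z"
  by (simp add: has_cderiv_def bounded_linear_imp_has_derivative
      bounded_bilinear.bounded_linear_left[OF bounded_bilinear_scaleC])

lemma lip_space_times_vector:
  fixes x :: "'a::complex_banach"
  shows "(\<lambda>w. w *\<^sub>C x) \<in> lip_space 1" and "lip_norm 1 (\<lambda>w. w *\<^sub>C x) \<le> 2 * norm x"
proof -
  have quotient: "q \<le> norm x" if "q \<in> holder_quotients 1 (\<lambda>w. w *\<^sub>C x)" for q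
    using that
    by (auto simp: holder_quotients_def norm_scaleC
        simp flip: bounded_bilinear.diff_left[OF bounded_bilinear_scaleC])
  then have "bdd_above (holder_quotients 1 (\<lambda>w. w *\<^sub>C x))"
    by (rule bdd_aboveI)
  moreover have "(\<lambda>w. w *\<^sub>C x) \<in> analytic_disc"
    using has_cderiv_times_vector by (rule analytic_discI)
  ultimately show "(\<lambda>w. w *\<^sub>C x) \<in> lip_space 1"
    unfolding lip_space_def by simp
  have "Sup (holder_quotients 1 (\<lambda>w. w *\<^sub>C x)) \<le> norm x"
    using quotient holder_quotients_nonempty[of 1 "\<lambda>w. w *\<^sub>C x"] by (intro cSup_least) auto
  moreover have "(SUP w\<in>unit_disc. norm (w *\<^sub>C x)) \<le> norm x"
    by (intro cSUP_least) (auto simp: norm_scaleC intro: mult_left_le_one_le)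
  ultimately show "lip_norm 1 (\<lambda>w. w *\<^sub>C x) \<le> 2 * norm x"
    by (simp add: lip_norm_def)
qed

section \<open>Weighted composition operators\<close>

context
  fixes \<beta> :: real and \<phi> :: "complex \<Rightarrow> complex"
    and \<psi> :: "complex \<Rightarrow> ('x::complex_banach, 'y::complex_banach) cblinfun"
  assumes \<beta>: "0 < \<beta>" "\<beta> \<le> 1"
    and \<phi>: "\<phi> holomorphic_on unit_disc" "\<phi> ` unit_disc \<subseteq> unit_disc"
    and \<psi>: "\<psi> \<in> analytic_disc"
begin

lemma \<phi>_in_disc: "z \<in> unit_disc \<Longrightarrow> \<phi> z \<in> unit_disc"
  using \<phi>(2) by blast

lemma has_cderiv_wcomp_disc:
  assumes "f \<in> analytic_disc" "z \<in> unit_disc"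
  shows "has_cderiv (wcomp \<psi> \<phi> f)
    (cblinfun_apply (cderiv \<psi> z) (f (\<phi> z))
      + cblinfun_apply (deriv \<phi> z *\<^sub>C \<psi> z) (cderiv f (\<phi> z))) z"
  by (intro has_cderiv_wcomp has_cderiv_cderiv \<psi> assms \<phi>_in_disc
      holomorphic_derivI[OF \<phi>(1) open_ball])

lemma deriv_scaleC_analytic: "(\<lambda>z. deriv \<phi> z *\<^sub>C \<psi> z) \<in> analytic_disc"
proof (rule analytic_discI)
  fix z assume z: "z \<in> unit_disc"
  show "has_cderiv (\<lambda>z. deriv \<phi> z *\<^sub>C \<psi> z)
      (deriv \<phi> z *\<^sub>C cderiv \<psi> z + deriv (deriv \<phi>) z *\<^sub>C \<psi> z) z"
    by (intro has_cderiv_scaleC has_cderiv_cderiv[OF \<psi> z]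
        holomorphic_derivI[OF holomorphic_deriv[OF \<phi>(1) open_ball] open_ball z])
qed

text \<open>
  The constant is \<open>193 = 1 + 12 * 16\<close>: the value at \<open>0\<close> contributes \<open>N\<close>, and each summand of the
  derivative is bounded by \<open>8 * N * lip_norm 1 f\<close>, which \<open>lip_space_if_weighted_cderiv_le\<close> multiplies
  by \<open>12\<close>.
\<close>

lemma wcomp_bound_if_multiplier:
  assumes \<psi>_lip: "\<psi> \<in> lip_space \<beta>"
    and H: "(\<lambda>z. deriv \<phi> z *\<^sub>C \<psi> z) \<in> Hinf_space (1 - \<beta>)"
    and f: "f \<in> lip_space 1"
  defines "N \<equiv> max (Hinf_norm (1 - \<beta>) (\<lambda>z. deriv \<phi> z *\<^sub>C \<psi> z)) (lip_norm \<beta> \<psi>)"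
  shows "wcomp \<psi> \<phi> f \<in> lip_space \<beta>" and "lip_norm \<beta> (wcomp \<psi> \<phi> f) \<le> 193 * N * lip_norm 1 f"
proof -
  define F where "F = lip_norm 1 f"
  have f_analytic: "f \<in> analytic_disc" using f by (simp add: lip_space_def)
  have fF: "norm (f z) \<le> F" "norm (cderiv f z) \<le> 8 * F" if "z \<in> unit_disc" for z
    using norm_le_lip_norm_one[OF f that] weighted_cderiv_le_lip_norm[OF f _ _ that] that
    by (simp_all add: weight_zero F_def)
  have F: "0 \<le> F" using fF(1)[of 0] by (smt (verit) centre_in_ball norm_ge_zero)
  have \<psi>0: "norm (\<psi> 0) \<le> N"
    using norm_zero_le_lip_norm[OF \<psi>_lip \<beta>] by (simp add: N_def)
  then have N: "0 \<le> N" by (rule order_trans[OF norm_ge_zero])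
  have \<psi>': "weight (1 - \<beta>) z * norm (cderiv \<psi> z) \<le> 8 * N" if "z \<in> unit_disc" for z
    using weighted_cderiv_le_lip_norm[OF \<psi>_lip \<beta> that] by (simp add: N_def)
  have \<phi>'\<psi>: "weight (1 - \<beta>) z * norm (deriv \<phi> z *\<^sub>C \<psi> z) \<le> N" if "z \<in> unit_disc" for z
  proof -
    have "weight (1 - \<beta>) z * norm (deriv \<phi> z *\<^sub>C \<psi> z) \<le> Hinf_norm (1 - \<beta>) (\<lambda>z. deriv \<phi> z *\<^sub>C \<psi> z)"
      unfolding Hinf_norm_def using H that by (intro cSUP_upper) (auto simp: Hinf_space_def)
    then show ?thesis by (simp add: N_def)
  qed
  note deriv = has_cderiv_wcomp_disc[OF f_analytic]
  have analytic: "wcomp \<psi> \<phi> f \<in> analytic_disc" using deriv by (rule analytic_discI)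
  have bound: "weight (1 - \<beta>) z * norm (cderiv (wcomp \<psi> \<phi> f) z) \<le> 16 * N * F"
    if z: "z \<in> unit_disc" for z
  proof -
    let ?\<nu> = "weight (1 - \<beta>) z"
    have "norm (cderiv (wcomp \<psi> \<phi> f) z)
        \<le> norm (cblinfun_apply (cderiv \<psi> z) (f (\<phi> z)))
          + norm (cblinfun_apply (deriv \<phi> z *\<^sub>C \<psi> z) (cderiv f (\<phi> z)))"
      unfolding has_cderiv_imp_cderiv[OF deriv[OF z]] by (rule norm_triangle_ineq)
    also have "\<dots> \<le> norm (cderiv \<psi> z) * F + norm (deriv \<phi> z *\<^sub>C \<psi> z) * (8 * F)"
      using fF[OF \<phi>_in_disc[OF z]]
      by (intro add_mono order_trans[OF norm_cblinfun_apply_le] mult_left_mono) auto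
    finally have "?\<nu> * norm (cderiv (wcomp \<psi> \<phi> f) z)
        \<le> ?\<nu> * (norm (cderiv \<psi> z) * F + norm (deriv \<phi> z *\<^sub>C \<psi> z) * (8 * F))"
      by (rule mult_left_mono[OF _ weight_nonneg])
    also have "\<dots> = (?\<nu> * norm (cderiv \<psi> z)) * F + (?\<nu> * norm (deriv \<phi> z *\<^sub>C \<psi> z)) * (8 * F)"
      by (simp add: algebra_simps)
    also have "\<dots> \<le> 8 * N * F + N * (8 * F)"
      using F \<psi>'[OF z] \<phi>'\<psi>[OF z] by (intro add_mono mult_right_mono) auto
    finally show ?thesis by (simp add: mult_ac)
  qed
  show "wcomp \<psi> \<phi> f \<in> lip_space \<beta>"
    using lip_space_if_weighted_cderiv_le(1)[OF analytic \<beta> bound] .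
  have "lip_norm \<beta> (wcomp \<psi> \<phi> f) \<le> norm (wcomp \<psi> \<phi> f 0) + 12 * (16 * N * F)"
    using lip_space_if_weighted_cderiv_le(2)[OF analytic \<beta> bound] .
  also have "norm (wcomp \<psi> \<phi> f 0) \<le> N * F"
    unfolding wcomp_def using \<psi>0 fF(1)[OF \<phi>_in_disc[of 0]] N
    by (intro order_trans[OF norm_cblinfun_apply_le] mult_mono) auto
  finally show "lip_norm \<beta> (wcomp \<psi> \<phi> f) \<le> 193 * N * lip_norm 1 f"
    by (simp add: F_def)
qed

text \<open>
  The test functions are the constants \<open>x\<close> and the functions \<open>w \<mapsto> w x\<close> with \<open>norm x \<le> 1/2\<close>. Only
  functions in the unit ball are tested, so that \<open>C\<close> may be the operator norm itself. The constant
  \<open>194 = 2 + 12 * 16\<close> comes from \<open>\<psi>\<close>; for \<open>\<phi>' \<psi>\<close> already \<open>32\<close> would do.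
\<close>

lemma multiplier_bound_if_wcomp:
  assumes W: "\<And>f. f \<in> lip_space 1 \<Longrightarrow> wcomp \<psi> \<phi> f \<in> lip_space \<beta>"
    and C: "\<And>f. f \<in> lip_space 1 \<Longrightarrow> lip_norm 1 f \<le> 1 \<Longrightarrow> lip_norm \<beta> (wcomp \<psi> \<phi> f) \<le> C"
  shows "\<psi> \<in> lip_space \<beta>" and "(\<lambda>z. deriv \<phi> z *\<^sub>C \<psi> z) \<in> Hinf_space (1 - \<beta>)"
    and "lip_norm \<beta> \<psi> \<le> 194 * C" and "Hinf_norm (1 - \<beta>) (\<lambda>z. deriv \<phi> z *\<^sub>C \<psi> z) \<le> 194 * C"
proof -
  have const: "wcomp \<psi> \<phi> (\<lambda>_. x) \<in> lip_space \<beta>" "lip_norm \<beta> (wcomp \<psi> \<phi> (\<lambda>_. x)) \<le> C"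
    if "norm x \<le> 1/2" for x
    using W C lip_space_const[of x] that by auto
  have times: "wcomp \<psi> \<phi> (\<lambda>w. w *\<^sub>C x) \<in> lip_space \<beta>" "lip_norm \<beta> (wcomp \<psi> \<phi> (\<lambda>w. w *\<^sub>C x)) \<le> C"
    if "norm x \<le> 1/2" for x
    using W C lip_space_times_vector[of x] that by auto
  have "1 * norm (\<psi> 0) \<le> 2 * C"
  proof (rule norm_cblinfun_le_half_ball)
    fix x :: 'x assume x: "norm x \<le> 1/2"
    show "1 * norm (cblinfun_apply (\<psi> 0) x) \<le> C"
      using norm_zero_le_lip_norm[OF const(1)[OF x] \<beta>] const(2)[OF x] by (simp add: wcomp_def)
  qed simp
  then have \<psi>0: "norm (\<psi> 0) \<le> 2 * C" by simp
  have \<psi>'x: "weight (1 - \<beta>) z * norm (cblinfun_apply (cderiv \<psi> z) x) \<le> 8 * C"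
    if z: "z \<in> unit_disc" and x: "norm x \<le> 1/2" for z x
  proof -
    have "cderiv (wcomp \<psi> \<phi> (\<lambda>_. x)) z = cblinfun_apply (cderiv \<psi> z) x"
      unfolding wcomp_def[abs_def]
      by (rule has_cderiv_imp_cderiv[OF has_cderiv_apply[OF has_cderiv_cderiv[OF \<psi> z]]])
    with weighted_cderiv_le_lip_norm[OF const(1)[OF x] \<beta> z] const(2)[OF x] show ?thesis by simp
  qed
  then have \<psi>': "weight (1 - \<beta>) z * norm (cderiv \<psi> z) \<le> 2 * (8 * C)" if "z \<in> unit_disc" for z
    using that by (intro norm_cblinfun_le_half_ball weight_nonneg)
  have \<phi>'\<psi>: "weight (1 - \<beta>) z * norm (deriv \<phi> z *\<^sub>C \<psi> z) \<le> 2 * (16 * C)"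
    if z: "z \<in> unit_disc" for z
  proof (rule norm_cblinfun_le_half_ball[OF weight_nonneg])
    fix x :: 'x assume x: "norm x \<le> 1/2"
    let ?\<nu> = "weight (1 - \<beta>) z" and ?g = "wcomp \<psi> \<phi> (\<lambda>w. w *\<^sub>C x)"
    have "cderiv ?g z = \<phi> z *\<^sub>C cblinfun_apply (cderiv \<psi> z) x
        + cblinfun_apply (deriv \<phi> z *\<^sub>C \<psi> z) x"
      using has_cderiv_imp_cderiv[OF has_cderiv_wcomp[OF has_cderiv_cderiv[OF \<psi> z]
          holomorphic_derivI[OF \<phi>(1) open_ball z] has_cderiv_times_vector]]
      by (simp add: cblinfun_apply_scaleC_right)
    then have "norm (cblinfun_apply (deriv \<phi> z *\<^sub>C \<psi> z) x)
        \<le> norm (cderiv ?g z) + norm (\<phi> z *\<^sub>C cblinfun_apply (cderiv \<psi> z) x)"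
      using norm_triangle_ineq4[of "cderiv ?g z" "\<phi> z *\<^sub>C cblinfun_apply (cderiv \<psi> z) x"] by simp
    also have "norm (\<phi> z *\<^sub>C cblinfun_apply (cderiv \<psi> z) x) \<le> norm (cblinfun_apply (cderiv \<psi> z) x)"
      using \<phi>_in_disc[OF z] by (auto simp: norm_scaleC intro: mult_left_le_one_le)
    finally have "?\<nu> * norm (cblinfun_apply (deriv \<phi> z *\<^sub>C \<psi> z) x)
        \<le> ?\<nu> * norm (cderiv ?g z) + ?\<nu> * norm (cblinfun_apply (cderiv \<psi> z) x)"
      using mult_left_mono[OF _ weight_nonneg] by (simp flip: distrib_left)
    also have "\<dots> \<le> 8 * C + 8 * C"
      using weighted_cderiv_le_lip_norm[OF times(1)[OF x] \<beta> z] times(2)[OF x] \<psi>'x[OF z x]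
      by (intro add_mono) auto
    finally show "?\<nu> * norm (cblinfun_apply (deriv \<phi> z *\<^sub>C \<psi> z) x) \<le> 16 * C" by simp
  qed
  have C0: "0 \<le> C" using \<psi>0 norm_ge_zero[of "\<psi> 0"] by linarith
  show "\<psi> \<in> lip_space \<beta>"
    using lip_space_if_weighted_cderiv_le(1)[OF \<psi> \<beta> \<psi>'] .
  show "lip_norm \<beta> \<psi> \<le> 194 * C"
    using lip_space_if_weighted_cderiv_le(2)[OF \<psi> \<beta> \<psi>'] \<psi>0 by simp
  have "bdd_above ((\<lambda>z. weight (1 - \<beta>) z * norm (deriv \<phi> z *\<^sub>C \<psi> z)) ` unit_disc)"
    using \<phi>'\<psi> by (rule bdd_aboveI2)
  with deriv_scaleC_analytic show "(\<lambda>z. deriv \<phi> z *\<^sub>C \<psi> z) \<in> Hinf_space (1 - \<beta>)"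
    by (simp add: Hinf_space_def)
  have "Hinf_norm (1 - \<beta>) (\<lambda>z. deriv \<phi> z *\<^sub>C \<psi> z) \<le> 2 * (16 * C)"
    unfolding Hinf_norm_def using \<phi>'\<psi> by (intro cSUP_least) auto
  then show "Hinf_norm (1 - \<beta>) (\<lambda>z. deriv \<phi> z *\<^sub>C \<psi> z) \<le> 194 * C" using C0 by simp
qed

text \<open>
  The constant \<open>C\<close> of a bounded operator may be negative, when all functions in question have norm
  zero, so its absolute value serves as the bound on the unit ball.
\<close>

lemma wcomp_lip_op_norm_upper:
  assumes "lip_bounded_op 1 \<beta> (wcomp \<psi> \<phi>)" "f \<in> lip_space 1" "lip_norm 1 f \<le> 1"
  shows "lip_norm \<beta> (wcomp \<psi> \<phi> f) \<le> lip_op_norm 1 \<beta> (wcomp \<psi> \<phi>)"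
  unfolding lip_op_norm_def
proof (rule cSUP_upper)
  obtain C where C: "\<And>g. g \<in> lip_space 1 \<Longrightarrow> lip_norm \<beta> (wcomp \<psi> \<phi> g) \<le> C * lip_norm 1 g"
    using assms(1) unfolding lip_bounded_op_def by blast
  show "bdd_above ((\<lambda>g. lip_norm \<beta> (wcomp \<psi> \<phi> g)) ` {g \<in> lip_space 1. lip_norm 1 g \<le> 1})"
  proof (rule bdd_aboveI2)
    fix g :: "complex \<Rightarrow> 'x" assume g: "g \<in> {g \<in> lip_space 1. lip_norm 1 g \<le> 1}"
    then have "0 \<le> lip_norm 1 g"
      using norm_le_lip_norm_one[of g 0] by (auto intro: order_trans[OF norm_ge_zero])
    then have "C * lip_norm 1 g \<le> \<bar>C\<bar> * 1"
      using g by (intro mult_mono) auto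
    then show "lip_norm \<beta> (wcomp \<psi> \<phi> g) \<le> \<bar>C\<bar>" using C[of g] g by simp
  qed
qed (use assms in simp)

lemma lip_bounded_op_wcomp_iff:
  "lip_bounded_op 1 \<beta> (wcomp \<psi> \<phi>) \<longleftrightarrow>
    \<psi> \<in> lip_space \<beta> \<and> (\<lambda>z. deriv \<phi> z *\<^sub>C \<psi> z) \<in> Hinf_space (1 - \<beta>)"
proof
  assume b: "lip_bounded_op 1 \<beta> (wcomp \<psi> \<phi>)"
  then have "wcomp \<psi> \<phi> f \<in> lip_space \<beta>" if "f \<in> lip_space 1" for f
    using that unfolding lip_bounded_op_def by blast
  from multiplier_bound_if_wcomp(1,2)[OF this wcomp_lip_op_norm_upper[OF b]]
  show "\<psi> \<in> lip_space \<beta> \<and> (\<lambda>z. deriv \<phi> z *\<^sub>C \<psi> z) \<in> Hinf_space (1 - \<beta>)" by simp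
next
  assume "\<psi> \<in> lip_space \<beta> \<and> (\<lambda>z. deriv \<phi> z *\<^sub>C \<psi> z) \<in> Hinf_space (1 - \<beta>)"
  then show "lip_bounded_op 1 \<beta> (wcomp \<psi> \<phi>)"
    unfolding lip_bounded_op_def using wcomp_bound_if_multiplier by blast
qed

lemma lip_op_norm_wcomp_bounds:
  assumes b: "lip_bounded_op 1 \<beta> (wcomp \<psi> \<phi>)"
  defines "N \<equiv> max (Hinf_norm (1 - \<beta>) (\<lambda>z. deriv \<phi> z *\<^sub>C \<psi> z)) (lip_norm \<beta> \<psi>)"
  shows "lip_op_norm 1 \<beta> (wcomp \<psi> \<phi>) \<le> 193 * N" and "N \<le> 194 * lip_op_norm 1 \<beta> (wcomp \<psi> \<phi>)"
proof -
  have W: "wcomp \<psi> \<phi> f \<in> lip_space \<beta>" if "f \<in> lip_space 1" for f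
    using that b unfolding lip_bounded_op_def by blast
  show "N \<le> 194 * lip_op_norm 1 \<beta> (wcomp \<psi> \<phi>)"
    using multiplier_bound_if_wcomp(3,4)[OF W wcomp_lip_op_norm_upper[OF b]] by (simp add: N_def)
  have mult: "\<psi> \<in> lip_space \<beta>" "(\<lambda>z. deriv \<phi> z *\<^sub>C \<psi> z) \<in> Hinf_space (1 - \<beta>)"
    using b lip_bounded_op_wcomp_iff by auto
  have N: "0 \<le> N"
    using order_trans[OF norm_ge_zero norm_zero_le_lip_norm[OF mult(1) \<beta>]] by (simp add: N_def)
  show "lip_op_norm 1 \<beta> (wcomp \<psi> \<phi>) \<le> 193 * N"
    unfolding lip_op_norm_def
  proof (rule cSUP_least)
    show "{f \<in> lip_space 1. lip_norm 1 f \<le> 1} \<noteq> ({} :: (complex \<Rightarrow> 'x) set)"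
      using lip_space_const[of "0::'x"] by auto
    fix f :: "complex \<Rightarrow> 'x" assume f: "f \<in> {f \<in> lip_space 1. lip_norm 1 f \<le> 1}"
    have "lip_norm \<beta> (wcomp \<psi> \<phi> f) \<le> 193 * N * lip_norm 1 f"
      unfolding N_def using f by (intro wcomp_bound_if_multiplier(2)[OF mult]) simp
    also have "\<dots> \<le> 193 * N" using f N by (intro mult_left_le) auto
    finally show "lip_norm \<beta> (wcomp \<psi> \<phi> f) \<le> 193 * N" .
  qed
qed

end

theorem theorem2p4:
  fixes \<beta> :: real
  assumes "0 < \<beta>" and "\<beta> \<le> 1"
  shows "(\<forall>(\<phi> :: complex \<Rightarrow> complex)
            (\<psi> :: complex \<Rightarrow> ('x::complex_banach, 'y::complex_banach) cblinfun).
          \<phi> holomorphic_on unit_disc \<and> \<phi> ` unit_disc \<subseteq> unit_disc \<and> \<psi> \<in> analytic_disc \<longrightarrow>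
            (lip_bounded_op 1 \<beta> (wcomp \<psi> \<phi>) \<longleftrightarrow>
             \<psi> \<in> lip_space \<beta> \<and> (\<lambda>z. deriv \<phi> z *\<^sub>C \<psi> z) \<in> Hinf_space (1 - \<beta>))) \<and>
    (\<exists>a > 0. \<exists>b > 0. \<forall>(\<phi> :: complex \<Rightarrow> complex) (\<psi> :: complex \<Rightarrow> ('x, 'y) cblinfun).
          \<phi> holomorphic_on unit_disc \<and> \<phi> ` unit_disc \<subseteq> unit_disc \<and> \<psi> \<in> analytic_disc \<and>
          lip_bounded_op 1 \<beta> (wcomp \<psi> \<phi>) \<longrightarrow>
            a * lip_op_norm 1 \<beta> (wcomp \<psi> \<phi>)
              \<le> max (Hinf_norm (1 - \<beta>) (\<lambda>z. deriv \<phi> z *\<^sub>C \<psi> z)) (lip_norm \<beta> \<psi>) \<and>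
            max (Hinf_norm (1 - \<beta>) (\<lambda>z. deriv \<phi> z *\<^sub>C \<psi> z)) (lip_norm \<beta> \<psi>)
              \<le> b * lip_op_norm 1 \<beta> (wcomp \<psi> \<phi>))"
proof (intro conjI allI impI)
  fix \<phi> :: "complex \<Rightarrow> complex" and \<psi> :: "complex \<Rightarrow> ('x, 'y) cblinfun"
  assume "\<phi> holomorphic_on unit_disc \<and> \<phi> ` unit_disc \<subseteq> unit_disc \<and> \<psi> \<in> analytic_disc"
  then show "lip_bounded_op 1 \<beta> (wcomp \<psi> \<phi>) \<longleftrightarrow>
      \<psi> \<in> lip_space \<beta> \<and> (\<lambda>z. deriv \<phi> z *\<^sub>C \<psi> z) \<in> Hinf_space (1 - \<beta>)"
    using lip_bounded_op_wcomp_iff[OF assms] by blast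
next
  show "\<exists>a > 0. \<exists>b > 0. \<forall>(\<phi> :: complex \<Rightarrow> complex) (\<psi> :: complex \<Rightarrow> ('x, 'y) cblinfun).
          \<phi> holomorphic_on unit_disc \<and> \<phi> ` unit_disc \<subseteq> unit_disc \<and> \<psi> \<in> analytic_disc \<and>
          lip_bounded_op 1 \<beta> (wcomp \<psi> \<phi>) \<longrightarrow>
            a * lip_op_norm 1 \<beta> (wcomp \<psi> \<phi>)
              \<le> max (Hinf_norm (1 - \<beta>) (\<lambda>z. deriv \<phi> z *\<^sub>C \<psi> z)) (lip_norm \<beta> \<psi>) \<and>
            max (Hinf_norm (1 - \<beta>) (\<lambda>z. deriv \<phi> z *\<^sub>C \<psi> z)) (lip_norm \<beta> \<psi>)
              \<le> b * lip_op_norm 1 \<beta> (wcomp \<psi> \<phi>)"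
  proof (rule exI[of _ "1/193"], intro conjI exI[of _ 194] allI impI; (elim conjE)?)
    fix \<phi> :: "complex \<Rightarrow> complex" and \<psi> :: "complex \<Rightarrow> ('x, 'y) cblinfun"
    assume \<phi>: "\<phi> holomorphic_on unit_disc" "\<phi> ` unit_disc \<subseteq> unit_disc" and \<psi>: "\<psi> \<in> analytic_disc"
      and b: "lip_bounded_op 1 \<beta> (wcomp \<psi> \<phi>)"
    note bounds = lip_op_norm_wcomp_bounds[OF assms \<phi> \<psi> b]
    show "1/193 * lip_op_norm 1 \<beta> (wcomp \<psi> \<phi>)
        \<le> max (Hinf_norm (1 - \<beta>) (\<lambda>z. deriv \<phi> z *\<^sub>C \<psi> z)) (lip_norm \<beta> \<psi>)"
      using bounds(1) by linarith
    show "max (Hinf_norm (1 - \<beta>) (\<lambda>z. deriv \<phi> z *\<^sub>C \<psi> z)) (lip_norm \<beta> \<psi>)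
        \<le> 194 * lip_op_norm 1 \<beta> (wcomp \<psi> \<phi>)"
      by (rule bounds(2))
  qed simp_all
qed

end
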